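(* The functor $\mathcal G:\mathbf{Diass}\to\mathbf{rAvg}$ is left adjoint to the functor $\mathcal F:\mathbf{rAvg}\to\mathbf{Diass}$ (both described in the context). More precisely, for any diassociative algebra $(D,\dashv,\vdash)$ and any relative averaging algebra $M\xrightarrow{P}A$, $$\mathrm{Hom}_{\mathbf{Diass}}(D,M_P)\cong\mathrm{Hom}_{\mathbf{rAvg}}(D\xrightarrow{q}D_{\mathrm{Ass}},\,M\xrightarrow{P}A).$$
   Context: Vector spaces are over a field of characteristic $0$; associative algebras are not assumed unital. $\mathbf{rAvg}$: a relative averaging algebra $M\xrightarrow{P}A$ consists of an associative algebra $A$, an $A$-bimodule $M$ (both actions written $\cdot_M$) and a linear map $P:M\to A$ with $P(u)\cdot P(v)=P(P(u)\cdot_Mv)=P(u\cdot_MP(v))$ for all $u,v\in M$. A morphism from $M\xrightarrow{P}A$ to $M'\xrightarrow{P'}A'$ is a pair $(\varphi,\psi)$ of an algebra morphism $\varphi:A\to A'$ and a linear map $\psi:M\to M'$ with $\psi(a\cdot_Mu)=\varphi(a)\cdot_{M'}\psi(u)$, $\psi(u\cdot_Ma)=\psi(u)\cdot_{M'}\varphi(a)$ and $\varphi\circ P=P'\circ\psi$. $\mathbf{Diass}$: a diassociative algebra is a vector space $D$ with bilinear operations $\dashv,\vdash$ satisfying $(a\dashv b)\dashv c=a\dashv(b\dashv c)=a\dashv(b\vdash c)$, $(a\vdash b)\dashv c=a\vdash(b\dashv c)$, $(a\dashv b)\vdash c=(a\vdash b)\vdash c=a\vdash(b\vdash c)$. Morphisms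 are linear maps preserving both operations. $\mathcal F$ sends $M\xrightarrow{P}A$ to $M_P$, the diassociative algebra $M$ with $u\dashv_Pv=u\cdot_MP(v)$, $u\vdash_Pv=P(u)\cdot_Mv$, and $(\varphi,\psi)$ to $\psi$. $\mathcal G$ sends $D$ to $D\xrightarrow{q}D_{\mathrm{Ass}}$: $D_{\mathrm{Ass}}$ is the quotient of $D$ by the ideal generated by all $a\dashv b-a\vdash b$, an associative algebra with $[a]\cdot[b]=[a\dashv b]=[a\vdash b]$; $D$ is a $D_{\mathrm{Ass}}$-bimodule by $[a]\cdot_Db=a\vdash b$, $b\cdot_D[a]=b\dashv a$; and $q:D\to D_{\mathrm{Ass}}$ is the quotient map. A morphism $\psi:D\to D'$ is sent to $(\varphi,\psi)$ with $\varphi([a])=[\psi(a)]$. *)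

theory Defs
  imports "HOL-Algebra.QuotRing" "HOL-Algebra.Module"
begin

section \<open>Linear and bilinear maps\<close>

text \<open>
  A vector space over a field \<open>K\<close> is a \<^locale>\<open>module\<close> over \<open>K\<close>.  As usual for that locale, the
  record fields \<open>mult\<close> and \<open>one\<close> of the underlying ring record play no role unless
  stated otherwise.  In particular associative algebras use \<open>mult\<close> but never \<open>one\<close>, so that
  they are not assumed unital.
\<close>

definition linear_map ::
  "('k, 'e) ring_scheme \<Rightarrow> ('k, 'v, 'f) module_scheme \<Rightarrow> ('k, 'w, 'g) module_scheme \<Rightarrow> ('v \<Rightarrow> 'w) \<Rightarrow> bool"
  where "linear_map K V W f \<longleftrightarrow>
    f \<in> carrier V \<rightarrow> carrier W \<and>
    (\<forall>u\<in>carrier V. \<forall>v\<in>carrier V. f (u \<oplus>\<^bsub>V\<^esub> v) = f u \<oplus>\<^bsub>W\<^esub> f v) \<and>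
    (\<forall>r\<in>carrier K. \<forall>v\<in>carrier V. f (r \<odot>\<^bsub>V\<^esub> v) = r \<odot>\<^bsub>W\<^esub> f v)"

definition bilinear_map ::
  "('k, 'e) ring_scheme \<Rightarrow> ('k, 'u, 'f) module_scheme \<Rightarrow> ('k, 'v, 'g) module_scheme \<Rightarrow>
   ('k, 'w, 'h) module_scheme \<Rightarrow> ('u \<Rightarrow> 'v \<Rightarrow> 'w) \<Rightarrow> bool"
  where "bilinear_map K U V W f \<longleftrightarrow>
    (\<forall>u\<in>carrier U. linear_map K V W (f u)) \<and>
    (\<forall>v\<in>carrier V. linear_map K U W (\<lambda>u. f u v))"


section \<open>Categories, functors and adjunctions\<close>

text \<open>
  Hom-sets are indexed by their endpoints and need not be disjoint; correspondingly the
  composition \<open>Comp C X Y Z g f\<close> of \<open>f : X \<rightarrow> Y\<close> and \<open>g : Y \<rightarrow> Z\<close> and the arrow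
  part \<open>F\<^sub>1 X Y f\<close> of a functor carry the objects involved.
\<close>

record ('o, 'h) cat =
  Obj :: "'o set"
  Hom :: "'o \<Rightarrow> 'o \<Rightarrow> 'h set"
  Ident :: "'o \<Rightarrow> 'h"
  Comp :: "'o \<Rightarrow> 'o \<Rightarrow> 'o \<Rightarrow> 'h \<Rightarrow> 'h \<Rightarrow> 'h"

definition category :: "('o, 'h) cat \<Rightarrow> bool"
  where "category C \<longleftrightarrow>
    (\<forall>X\<in>Obj C. Ident C X \<in> Hom C X X) \<and>
    (\<forall>X\<in>Obj C. \<forall>Y\<in>Obj C. \<forall>Z\<in>Obj C. \<forall>f\<in>Hom C X Y. \<forall>g\<in>Hom C Y Z.
        Comp C X Y Z g f \<in> Hom C X Z) \<and>
    (\<forall>X\<in>Obj C. \<forall>Y\<in>Obj C. \<forall>f\<in>Hom C X Y.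
        Comp C X X Y f (Ident C X) = f \<and> Comp C X Y Y (Ident C Y) f = f) \<and>
    (\<forall>W\<in>Obj C. \<forall>X\<in>Obj C. \<forall>Y\<in>Obj C. \<forall>Z\<in>Obj C.
      \<forall>f\<in>Hom C W X. \<forall>g\<in>Hom C X Y. \<forall>h\<in>Hom C Y Z.
        Comp C W X Z (Comp C X Y Z h g) f = Comp C W Y Z h (Comp C W X Y g f))"

definition is_functor ::
  "('o, 'h) cat \<Rightarrow> ('p, 'i) cat \<Rightarrow> ('o \<Rightarrow> 'p) \<Rightarrow> ('o \<Rightarrow> 'o \<Rightarrow> 'h \<Rightarrow> 'i) \<Rightarrow> bool"
  where "is_functor C D F0 F1 \<longleftrightarrow>
    (\<forall>X\<in>Obj C. F0 X \<in> Obj D) \<and>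
    (\<forall>X\<in>Obj C. \<forall>Y\<in>Obj C. \<forall>f\<in>Hom C X Y. F1 X Y f \<in> Hom D (F0 X) (F0 Y)) \<and>
    (\<forall>X\<in>Obj C. F1 X X (Ident C X) = Ident D (F0 X)) \<and>
    (\<forall>X\<in>Obj C. \<forall>Y\<in>Obj C. \<forall>Z\<in>Obj C. \<forall>f\<in>Hom C X Y. \<forall>g\<in>Hom C Y Z.
        F1 X Z (Comp C X Y Z g f) = Comp D (F0 X) (F0 Y) (F0 Z) (F1 Y Z g) (F1 X Y f))"

text \<open>
  \<open>left_adjoint C D G0 G1 F0 F1\<close>: the functor \<open>(G0, G1) : C \<rightarrow> D\<close> is left adjoint to the
  functor \<open>(F0, F1) : D \<rightarrow> C\<close>, by a bijection
  \<open>Hom\<^sub>C(X, F0 Y) \<cong> Hom\<^sub>D(G0 X, Y)\<close> natural in \<open>X\<close> and \<open>Y\<close>.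
\<close>

definition left_adjoint ::
  "('o, 'h) cat \<Rightarrow> ('p, 'i) cat \<Rightarrow> ('o \<Rightarrow> 'p) \<Rightarrow> ('o \<Rightarrow> 'o \<Rightarrow> 'h \<Rightarrow> 'i) \<Rightarrow>
   ('p \<Rightarrow> 'o) \<Rightarrow> ('p \<Rightarrow> 'p \<Rightarrow> 'i \<Rightarrow> 'h) \<Rightarrow> bool"
  where "left_adjoint C D G0 G1 F0 F1 \<longleftrightarrow>
    category C \<and> category D \<and> is_functor C D G0 G1 \<and> is_functor D C F0 F1 \<and>
    (\<exists>\<Phi>.
      (\<forall>X\<in>Obj C. \<forall>Y\<in>Obj D. bij_betw (\<Phi> X Y) (Hom C X (F0 Y)) (Hom D (G0 X) Y)) \<and>
      (\<forall>X\<in>Obj C. \<forall>X'\<in>Obj C. \<forall>Y\<in>Obj D. \<forall>Y'\<in>Obj D.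
        \<forall>f\<in>Hom C X' X. \<forall>g\<in>Hom D Y Y'. \<forall>h\<in>Hom C X (F0 Y).
          \<Phi> X' Y' (Comp C X' X (F0 Y') (Comp C X (F0 Y) (F0 Y') (F1 Y Y' g) h) f) =
          Comp D (G0 X') (G0 X) Y' (Comp D (G0 X) Y Y' g (\<Phi> X Y h)) (G1 X' X f)))"


section \<open>Diassociative algebras\<close>

record ('k, 'v) diass = "('k, 'v) module" +
  dleft :: "'v \<Rightarrow> 'v \<Rightarrow> 'v" (infixl \<open>\<stileturn>\<index>\<close> 70)
  dright :: "'v \<Rightarrow> 'v \<Rightarrow> 'v" (infixl \<open>\<turnstile>\<index>\<close> 70)

locale diassociative_algebra = module K D for K (structure) and D (structure) +
  assumes dleft_bilinear: "bilinear_map K D D D (dleft D)"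
    and dright_bilinear: "bilinear_map K D D D (dright D)"
    and dleft_dleft:
      "\<lbrakk>a \<in> carrier D; b \<in> carrier D; c \<in> carrier D\<rbrakk> \<Longrightarrow>
        (a \<stileturn>\<^bsub>D\<^esub> b) \<stileturn>\<^bsub>D\<^esub> c = a \<stileturn>\<^bsub>D\<^esub> (b \<stileturn>\<^bsub>D\<^esub> c)"
    and dleft_dright:
      "\<lbrakk>a \<in> carrier D; b \<in> carrier D; c \<in> carrier D\<rbrakk> \<Longrightarrow>
        a \<stileturn>\<^bsub>D\<^esub> (b \<stileturn>\<^bsub>D\<^esub> c) = a \<stileturn>\<^bsub>D\<^esub> (b \<turnstile>\<^bsub>D\<^esub> c)"
    and dright_dleft:
      "\<lbrakk>a \<in> carrier D; b \<in> carrier D; c \<in> carrier D\<rbrakk> \<Longrightarrow>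
        (a \<turnstile>\<^bsub>D\<^esub> b) \<stileturn>\<^bsub>D\<^esub> c = a \<turnstile>\<^bsub>D\<^esub> (b \<stileturn>\<^bsub>D\<^esub> c)"
    and dleft_then_dright:
      "\<lbrakk>a \<in> carrier D; b \<in> carrier D; c \<in> carrier D\<rbrakk> \<Longrightarrow>
        (a \<stileturn>\<^bsub>D\<^esub> b) \<turnstile>\<^bsub>D\<^esub> c = (a \<turnstile>\<^bsub>D\<^esub> b) \<turnstile>\<^bsub>D\<^esub> c"
    and dright_dright:
      "\<lbrakk>a \<in> carrier D; b \<in> carrier D; c \<in> carrier D\<rbrakk> \<Longrightarrow>
        (a \<turnstile>\<^bsub>D\<^esub> b) \<turnstile>\<^bsub>D\<^esub> c = a \<turnstile>\<^bsub>D\<^esub> (b \<turnstile>\<^bsub>D\<^esub> c)"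

text \<open>
  Morphisms are represented by extensional functions on the carrier (hence \<open>\<rightarrow>\<^sub>E\<close>), so that
  equality of morphisms is equality in the logic.
\<close>

definition diass_hom ::
  "('k, 'e) ring_scheme \<Rightarrow> ('k, 'v) diass \<Rightarrow> ('k, 'w) diass \<Rightarrow> ('v \<Rightarrow> 'w) set"
  where "diass_hom K D D' =
    {\<psi> \<in> carrier D \<rightarrow>\<^sub>E carrier D'. linear_map K D D' \<psi> \<and>
      (\<forall>a\<in>carrier D. \<forall>b\<in>carrier D.
        \<psi> (a \<stileturn>\<^bsub>D\<^esub> b) = \<psi> a \<stileturn>\<^bsub>D'\<^esub> \<psi> b \<and> \<psi> (a \<turnstile>\<^bsub>D\<^esub> b) = \<psi> a \<turnstile>\<^bsub>D'\<^esub> \<psi> b)}"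

definition diass_comp :: "('k, 'v) diass \<Rightarrow> ('w \<Rightarrow> 'x) \<Rightarrow> ('v \<Rightarrow> 'w) \<Rightarrow> 'v \<Rightarrow> 'x"
  where "diass_comp D g f = compose (carrier D) g f"

definition Diass :: "('k, 'e) ring_scheme \<Rightarrow> (('k, 'v) diass, 'v \<Rightarrow> 'v) cat"
  where "Diass K =
    \<lparr>Obj = {D. diassociative_algebra K D},
     Hom = diass_hom K,
     Ident = (\<lambda>D. \<lambda>x\<in>carrier D. x),
     Comp = (\<lambda>D _ _. diass_comp D)\<rparr>"


section \<open>Relative averaging algebras\<close>

locale assoc_algebra = module K A for K (structure) and A (structure) +
  assumes mult_bilinear: "bilinear_map K A A A (mult A)"
    and mult_assoc:
      "\<lbrakk>a \<in> carrier A; b \<in> carrier A; c \<in> carrier A\<rbrakk> \<Longrightarrow>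
        (a \<otimes>\<^bsub>A\<^esub> b) \<otimes>\<^bsub>A\<^esub> c = a \<otimes>\<^bsub>A\<^esub> (b \<otimes>\<^bsub>A\<^esub> c)"

locale assoc_bimodule = A: assoc_algebra K A + M: module K M
  for K (structure) and A (structure) and M (structure) +
  fixes l :: "'c \<Rightarrow> 'f \<Rightarrow> 'f" and r :: "'f \<Rightarrow> 'c \<Rightarrow> 'f"
  assumes l_bilinear: "bilinear_map K A M M l"
    and r_bilinear: "bilinear_map K M A M r"
    and l_l: "\<lbrakk>a \<in> carrier A; b \<in> carrier A; u \<in> carrier M\<rbrakk> \<Longrightarrow>
        l (a \<otimes>\<^bsub>A\<^esub> b) u = l a (l b u)"
    and l_r: "\<lbrakk>a \<in> carrier A; b \<in> carrier A; u \<in> carrier M\<rbrakk> \<Longrightarrow>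
        r (l a u) b = l a (r u b)"
    and r_r: "\<lbrakk>a \<in> carrier A; b \<in> carrier A; u \<in> carrier M\<rbrakk> \<Longrightarrow>
        r (r u a) b = r u (a \<otimes>\<^bsub>A\<^esub> b)"

record ('k, 'm, 'a) ravg =
  alg :: "('k, 'a) module"
  bim :: "('k, 'm) module"
  lact :: "'a \<Rightarrow> 'm \<Rightarrow> 'm"
  ract :: "'m \<Rightarrow> 'a \<Rightarrow> 'm"
  avg :: "'m \<Rightarrow> 'a"

definition rel_avg_algebra :: "('k, 'e) ring_scheme \<Rightarrow> ('k, 'm, 'a) ravg \<Rightarrow> bool"
  where "rel_avg_algebra K R \<longleftrightarrow>
    assoc_bimodule K (alg R) (bim R) (lact R) (ract R) \<and>
    linear_map K (bim R) (alg R) (avg R) \<and>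
    (\<forall>u\<in>carrier (bim R). \<forall>v\<in>carrier (bim R).
      avg R u \<otimes>\<^bsub>alg R\<^esub> avg R v = avg R (lact R (avg R u) v) \<and>
      avg R u \<otimes>\<^bsub>alg R\<^esub> avg R v = avg R (ract R u (avg R v)))"

definition ravg_hom ::
  "('k, 'e) ring_scheme \<Rightarrow> ('k, 'm, 'a) ravg \<Rightarrow> ('k, 'n, 'b) ravg \<Rightarrow> (('a \<Rightarrow> 'b) \<times> ('m \<Rightarrow> 'n)) set"
  where "ravg_hom K R R' =
    {(\<phi>, \<psi>).
      \<phi> \<in> carrier (alg R) \<rightarrow>\<^sub>E carrier (alg R') \<and> linear_map K (alg R) (alg R') \<phi> \<and>
      (\<forall>a\<in>carrier (alg R). \<forall>b\<in>carrier (alg R).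
        \<phi> (a \<otimes>\<^bsub>alg R\<^esub> b) = \<phi> a \<otimes>\<^bsub>alg R'\<^esub> \<phi> b) \<and>
      \<psi> \<in> carrier (bim R) \<rightarrow>\<^sub>E carrier (bim R') \<and> linear_map K (bim R) (bim R') \<psi> \<and>
      (\<forall>a\<in>carrier (alg R). \<forall>u\<in>carrier (bim R).
        \<psi> (lact R a u) = lact R' (\<phi> a) (\<psi> u) \<and> \<psi> (ract R u a) = ract R' (\<psi> u) (\<phi> a)) \<and>
      (\<forall>u\<in>carrier (bim R). \<phi> (avg R u) = avg R' (\<psi> u))}"

definition ravg_comp ::
  "('k, 'm, 'a) ravg \<Rightarrow> ('b \<Rightarrow> 'c) \<times> ('n \<Rightarrow> 'p) \<Rightarrow> ('a \<Rightarrow> 'b) \<times> ('m \<Rightarrow> 'n) \<Rightarrow> ('a \<Rightarrow> 'c) \<times> ('m \<Rightarrow> 'p)"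
  where "ravg_comp R g f =
    (compose (carrier (alg R)) (fst g) (fst f), compose (carrier (bim R)) (snd g) (snd f))"

definition rAvg ::
  "('k, 'e) ring_scheme \<Rightarrow> (('k, 'm, 'a) ravg, ('a \<Rightarrow> 'a) \<times> ('m \<Rightarrow> 'm)) cat"
  where "rAvg K =
    \<lparr>Obj = {R. rel_avg_algebra K R},
     Hom = ravg_hom K,
     Ident = (\<lambda>R. (\<lambda>a\<in>carrier (alg R). a, \<lambda>u\<in>carrier (bim R). u)),
     Comp = (\<lambda>R _ _. ravg_comp R)\<rparr>"


section \<open>The functor from relative averaging algebras to diassociative algebras\<close>

definition F_obj :: "('k, 'm, 'a) ravg \<Rightarrow> ('k, 'm) diass"
  where "F_obj R =
    \<lparr>carrier = carrier (bim R), mult = mult (bim R), one = one (bim R),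
     zero = zero (bim R), add = add (bim R), smult = smult (bim R),
     dleft = (\<lambda>u v. ract R u (avg R v)),
     dright = (\<lambda>u v. lact R (avg R u) v)\<rparr>"

definition F_mor ::
  "('k, 'm, 'a) ravg \<Rightarrow> ('k, 'n, 'b) ravg \<Rightarrow> ('a \<Rightarrow> 'b) \<times> ('m \<Rightarrow> 'n) \<Rightarrow> 'm \<Rightarrow> 'n"
  where "F_mor R R' = snd"


section \<open>The functor from diassociative algebras to relative averaging algebras\<close>

definition diass_ideal :: "('k, 'e) ring_scheme \<Rightarrow> ('k, 'v) diass \<Rightarrow> 'v set \<Rightarrow> bool"
  where "diass_ideal K D I \<longleftrightarrow> submodule I K D \<and>
    (\<forall>x\<in>I. \<forall>a\<in>carrier D.
      x \<stileturn>\<^bsub>D\<^esub> a \<in> I \<and> a \<stileturn>\<^bsub>D\<^esub> x \<in> I \<and> x \<turnstile>\<^bsub>D\<^esub> a \<in> I \<and> a \<turnstile>\<^bsub>D\<^esub> x \<in> I)"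

definition genideal_diass :: "('k, 'e) ring_scheme \<Rightarrow> ('k, 'v) diass \<Rightarrow> 'v set \<Rightarrow> 'v set"
  where "genideal_diass K D S = \<Inter>{I. diass_ideal K D I \<and> S \<subseteq> I}"

definition ass_ideal :: "('k, 'e) ring_scheme \<Rightarrow> ('k, 'v) diass \<Rightarrow> 'v set"
  where "ass_ideal K D =
    genideal_diass K D {a \<stileturn>\<^bsub>D\<^esub> b \<ominus>\<^bsub>D\<^esub> a \<turnstile>\<^bsub>D\<^esub> b | a b. a \<in> carrier D \<and> b \<in> carrier D}"

definition ass_class :: "('k, 'e) ring_scheme \<Rightarrow> ('k, 'v) diass \<Rightarrow> 'v \<Rightarrow> 'v set"
  where "ass_class K D a = ass_ideal K D +>\<^bsub>D\<^esub> a"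

text \<open>
  The elements of the quotient are the additive cosets, and the operations are defined on
  representatives as for \<^const>\<open>FactRing\<close>.  The field \<open>one\<close> has no meaning here.
\<close>

definition ass_quot :: "('k, 'e) ring_scheme \<Rightarrow> ('k, 'v) diass \<Rightarrow> ('k, 'v set) module"
  where "ass_quot K D =
    \<lparr>carrier = a_rcosets\<^bsub>D\<^esub> (ass_ideal K D),
     mult = (\<lambda>X Y. \<Union>a\<in>X. \<Union>b\<in>Y. ass_class K D (a \<stileturn>\<^bsub>D\<^esub> b)),
     one = undefined,
     zero = ass_ideal K D,
     add = set_add D,
     smult = (\<lambda>r X. \<Union>a\<in>X. ass_class K D (r \<odot>\<^bsub>D\<^esub> a))\<rparr>"

text \<open>
  Below, \<^const>\<open>the_elem\<close> extracts the common value, over all representatives \<open>a\<close> of a coset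
  \<open>X\<close>, of an expression in \<open>a\<close>.
\<close>

definition G_obj :: "('k, 'e) ring_scheme \<Rightarrow> ('k, 'v) diass \<Rightarrow> ('k, 'v, 'v set) ravg"
  where "G_obj K D =
    \<lparr>alg = ass_quot K D,
     bim = module.truncate D,
     lact = (\<lambda>X b. the_elem ((\<lambda>a. a \<turnstile>\<^bsub>D\<^esub> b) ` X)),
     ract = (\<lambda>b X. the_elem ((\<lambda>a. b \<stileturn>\<^bsub>D\<^esub> a) ` X)),
     avg = ass_class K D\<rparr>"

definition G_mor ::
  "('k, 'e) ring_scheme \<Rightarrow> ('k, 'v) diass \<Rightarrow> ('k, 'w) diass \<Rightarrow> ('v \<Rightarrow> 'w) \<Rightarrow>
   ('v set \<Rightarrow> 'w set) \<times> ('v \<Rightarrow> 'w)"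
  where "G_mor K D D' \<psi> =
    (\<lambda>X\<in>carrier (ass_quot K D). the_elem ((\<lambda>a. ass_class K D' (\<psi> a)) ` X), \<psi>)"

end

theory Submission
  imports Defs
begin

text \<open>
  A morphism \<open>(\<phi>, \<psi>)\<close> out of \<open>D \<rightarrow> D\<^sub>A\<^sub>s\<^sub>s\<close> is determined by \<open>\<psi>\<close>, because the quotient map is
  onto and \<open>\<phi> [a] = P (\<psi> a)\<close>.  Conversely, for a morphism \<open>\<psi> : D \<rightarrow> M\<^sub>P\<close> the map \<open>P \<circ> \<psi>\<close> is
  multiplicative for both products, so its kernel is an ideal containing all \<open>a \<stileturn> b - a \<turnstile> b\<close>, and
  \<open>P \<circ> \<psi>\<close> descends to \<open>D\<^sub>A\<^sub>s\<^sub>s\<close>.  The actions of \<open>D\<^sub>A\<^sub>s\<^sub>s\<close> on \<open>D\<close> are well defined because the elements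
  \<open>x\<close> with \<open>x \<turnstile> b = 0 = b \<stileturn> x\<close> for all \<open>b\<close> form such an ideal as well.
\<close>

section \<open>Linear maps\<close>

lemma linear_map_closed:
  "linear_map K V W f \<Longrightarrow> v \<in> carrier V \<Longrightarrow> f v \<in> carrier W"
  unfolding linear_map_def by blast

lemma linear_map_add:
  "linear_map K V W f \<Longrightarrow> u \<in> carrier V \<Longrightarrow> v \<in> carrier V \<Longrightarrow> f (u \<oplus>\<^bsub>V\<^esub> v) = f u \<oplus>\<^bsub>W\<^esub> f v"
  unfolding linear_map_def by blast

lemma linear_map_smult:
  "linear_map K V W f \<Longrightarrow> r \<in> carrier K \<Longrightarrow> v \<in> carrier V \<Longrightarrow> f (r \<odot>\<^bsub>V\<^esub> v) = r \<odot>\<^bsub>W\<^esub> f v"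
  unfolding linear_map_def by blast

lemma linear_mapI:
  assumes "\<And>v. v \<in> carrier V \<Longrightarrow> f v \<in> carrier W"
    and "\<And>u v. u \<in> carrier V \<Longrightarrow> v \<in> carrier V \<Longrightarrow> f (u \<oplus>\<^bsub>V\<^esub> v) = f u \<oplus>\<^bsub>W\<^esub> f v"
    and "\<And>r v. r \<in> carrier K \<Longrightarrow> v \<in> carrier V \<Longrightarrow> f (r \<odot>\<^bsub>V\<^esub> v) = r \<odot>\<^bsub>W\<^esub> f v"
  shows "linear_map K V W f"
  unfolding linear_map_def using assms by blast

text \<open>\<open>linear_map\<close> asks only for sums and scalars, but zero is the scalar
  multiple of itself by the zero of \<open>K\<close>. The negative is treated in the same way below,
  as a multiple by minus one.\<close>

lemma linear_map_zero:
  assumes "module K V" "module K W" "linear_map K V W f"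
  shows "f \<zero>\<^bsub>V\<^esub> = \<zero>\<^bsub>W\<^esub>"
proof -
  interpret V: module K V by fact
  interpret W: module K W by fact
  have "f \<zero>\<^bsub>V\<^esub> = f (\<zero>\<^bsub>K\<^esub> \<odot>\<^bsub>V\<^esub> \<zero>\<^bsub>V\<^esub>)" by simp
  also have "\<dots> = \<zero>\<^bsub>K\<^esub> \<odot>\<^bsub>W\<^esub> f \<zero>\<^bsub>V\<^esub>"
    by (rule linear_map_smult[OF assms(3)]) auto
  also have "\<dots> = \<zero>\<^bsub>W\<^esub>"
    using linear_map_closed[OF assms(3)] by simp
  finally show ?thesis .
qed

lemma linear_map_uminus:
  assumes "module K V" "module K W" "linear_map K V W f" and v: "v \<in> carrier V"
  shows "f (\<ominus>\<^bsub>V\<^esub> v) = \<ominus>\<^bsub>W\<^esub> f v"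
proof -
  interpret V: module K V by fact
  interpret W: module K W by fact
  have "f (\<ominus>\<^bsub>V\<^esub> v) = f ((\<ominus>\<^bsub>K\<^esub> \<one>\<^bsub>K\<^esub>) \<odot>\<^bsub>V\<^esub> v)" using v by (simp add: V.smult_l_minus)
  also have "\<dots> = (\<ominus>\<^bsub>K\<^esub> \<one>\<^bsub>K\<^esub>) \<odot>\<^bsub>W\<^esub> f v"
    by (rule linear_map_smult[OF assms(3)]) (auto simp: v)
  also have "\<dots> = \<ominus>\<^bsub>W\<^esub> f v"
    using linear_map_closed[OF assms(3) v] by (simp add: W.smult_l_minus)
  finally show ?thesis .
qed

lemma linear_map_minus:
  assumes "module K V" "module K W" "linear_map K V W f" and "u \<in> carrier V" "v \<in> carrier V"
  shows "f (u \<ominus>\<^bsub>V\<^esub> v) = f u \<ominus>\<^bsub>W\<^esub> f v"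
proof -
  interpret V: module K V by fact
  show ?thesis
    using assms by (simp add: a_minus_def linear_map_add linear_map_uminus)
qed

lemma linear_map_compose:
  assumes "linear_map K U V f" "linear_map K V W g"
  shows "linear_map K U W (\<lambda>u. g (f u))"
  by (rule linear_mapI)
    (simp_all add: linear_map_closed[OF assms(1)] linear_map_closed[OF assms(2)]
      linear_map_add[OF assms(1)] linear_map_add[OF assms(2)]
      linear_map_smult[OF assms(1)] linear_map_smult[OF assms(2)])

text \<open>Linearity sees values on the carrier only, and \<open>module K V\<close> keeps sums and
  multiples inside it. This covers restricted functions and the actions defined through
  \<open>the_elem\<close>.\<close>

lemma linear_map_cong:
  assumes "module K V" "linear_map K V W f" "\<And>v. v \<in> carrier V \<Longrightarrow> g v = f v"
  shows "linear_map K V W g"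
proof -
  interpret V: module K V by fact
  show ?thesis
    by (rule linear_mapI)
      (simp_all add: assms(3) linear_map_closed[OF assms(2)]
        linear_map_add[OF assms(2)] linear_map_smult[OF assms(2)])
qed

lemma linear_map_id: "linear_map K V V (\<lambda>v. v)"
  by (simp add: linear_map_def)

lemma bilinear_map_right: "bilinear_map K U V W f \<Longrightarrow> u \<in> carrier U \<Longrightarrow> linear_map K V W (f u)"
  by (simp add: bilinear_map_def)

lemma bilinear_map_left:
  "bilinear_map K U V W f \<Longrightarrow> v \<in> carrier V \<Longrightarrow> linear_map K U W (\<lambda>u. f u v)"
  by (simp add: bilinear_map_def)

lemma bilinear_map_closed:
  "bilinear_map K U V W f \<Longrightarrow> u \<in> carrier U \<Longrightarrow> v \<in> carrier V \<Longrightarrow> f u v \<in> carrier W"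
  by (rule linear_map_closed[OF bilinear_map_right])

text \<open>The module laws speak about these four fields alone, so they pass between records of
  different types. The cases needed are \<open>bim (G_obj K D)\<close> and
  \<open>F_obj R\<close>.\<close>

lemma module_transfer:
  assumes "module K V"
    and "carrier W = carrier V" "zero W = zero V" "add W = add V" "smult W = smult V"
  shows "module K W"
proof -
  interpret V: module K V by fact
  show ?thesis
  proof (rule moduleI[OF V.R.is_cring abelian_groupI])
    show "\<exists>y\<in>carrier W. y \<oplus>\<^bsub>W\<^esub> x = \<zero>\<^bsub>W\<^esub>" if "x \<in> carrier W" for x
      using that by (intro bexI[of _ "\<ominus>\<^bsub>V\<^esub> x"]) (simp_all add: assms(2-) V.M.l_neg)
  qed (simp_all add: assms(2-) V.M.a_assoc V.M.a_comm V.M.a_lcomm V.smult_l_distr V.smult_r_distr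
      V.smult_assoc1)
qed


section \<open>The associative quotient of a diassociative algebra\<close>

text \<open>The assumptions are those of \<open>diassociative_algebra\<close>; the types are named
  so that the quotient and its map can be given typed abbreviations.\<close>

locale diass_quotient = diassociative_algebra K D
  for K :: "('k, 'e) ring_scheme" (structure) and D :: "('k, 'v) diass" (structure)
begin

abbreviation I :: "'v set" where "I \<equiv> ass_ideal K D"
abbreviation Q :: "('k, 'v set) module" where "Q \<equiv> ass_quot K D"
abbreviation q :: "'v \<Rightarrow> 'v set" where "q \<equiv> ass_class K D"

lemma module_D: "module K D"
  by unfold_locales

lemmas dleft_closed [simp, intro] = bilinear_map_closed[OF dleft_bilinear]
lemmas dright_closed [simp, intro] = bilinear_map_closed[OF dright_bilinear]

lemma zero_products [simp]:
  assumes "a \<in> carrier D"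
  shows "a \<stileturn>\<^bsub>D\<^esub> \<zero>\<^bsub>D\<^esub> = \<zero>\<^bsub>D\<^esub>" "\<zero>\<^bsub>D\<^esub> \<stileturn>\<^bsub>D\<^esub> a = \<zero>\<^bsub>D\<^esub>"
    and "a \<turnstile>\<^bsub>D\<^esub> \<zero>\<^bsub>D\<^esub> = \<zero>\<^bsub>D\<^esub>" "\<zero>\<^bsub>D\<^esub> \<turnstile>\<^bsub>D\<^esub> a = \<zero>\<^bsub>D\<^esub>"
  using assms linear_map_zero[OF module_D module_D]
    bilinear_map_left[OF dleft_bilinear] bilinear_map_right[OF dleft_bilinear]
    bilinear_map_left[OF dright_bilinear] bilinear_map_right[OF dright_bilinear]
  by blast+

section \<open>Ideals of a diassociative algebra\<close>

lemma diass_ideal_carrier: "diass_ideal K D (carrier D)"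
  by (auto simp: diass_ideal_def carrier_is_submodule)

text \<open>The empty family is excluded because its intersection is the whole type. For the
  generated ideal, \<open>carrier D\<close> is always a member of the family.\<close>

lemma diass_ideal_Inter:
  assumes "\<J> \<noteq> {}" and J: "\<And>J. J \<in> \<J> \<Longrightarrow> diass_ideal K D J"
  shows "diass_ideal K D (\<Inter>\<J>)"
  unfolding diass_ideal_def
proof
  have sub: "submodule J K D" if "J \<in> \<J>" for J
    using J[OF that] by (simp add: diass_ideal_def)
  show "submodule (\<Inter>\<J>) K D"
  proof (rule submoduleI)
    show "\<Inter>\<J> \<subseteq> carrier D"
      using assms(1) submoduleE(1)[OF sub] by blast
    show "\<zero>\<^bsub>D\<^esub> \<in> \<Inter>\<J>"
      using subgroup.one_closed[OF submodule.axioms(1)[OF sub]] by auto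
  qed (use submoduleE(3-5)[OF sub] in auto)
  show "\<forall>x\<in>\<Inter>\<J>. \<forall>a\<in>carrier D. x \<stileturn>\<^bsub>D\<^esub> a \<in> \<Inter>\<J> \<and> a \<stileturn>\<^bsub>D\<^esub> x \<in> \<Inter>\<J> \<and>
      x \<turnstile>\<^bsub>D\<^esub> a \<in> \<Inter>\<J> \<and> a \<turnstile>\<^bsub>D\<^esub> x \<in> \<Inter>\<J>"
    using J by (simp add: diass_ideal_def)
qed

text \<open>The induction principle for \<open>I\<close>. It is used twice: for the elements that
  act as zero, and for the kernel of \<open>P \<circ> h\<close>.\<close>

lemma ass_ideal_least:
  assumes "diass_ideal K D J"
    and "\<And>a b. a \<in> carrier D \<Longrightarrow> b \<in> carrier D \<Longrightarrow> a \<stileturn>\<^bsub>D\<^esub> b \<ominus>\<^bsub>D\<^esub> a \<turnstile>\<^bsub>D\<^esub> b \<in> J"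
  shows "I \<subseteq> J"
  unfolding ass_ideal_def genideal_diass_def using assms by blast

lemma diass_ideal_ass_ideal: "diass_ideal K D I"
  unfolding ass_ideal_def genideal_diass_def
  by (rule diass_ideal_Inter) (use diass_ideal_carrier in auto)

lemma ass_ideal_generator:
  "a \<in> carrier D \<Longrightarrow> b \<in> carrier D \<Longrightarrow> a \<stileturn>\<^bsub>D\<^esub> b \<ominus>\<^bsub>D\<^esub> a \<turnstile>\<^bsub>D\<^esub> b \<in> I"
  unfolding ass_ideal_def genideal_diass_def by blast

lemma submodule_ass_ideal: "submodule I K D"
  using diass_ideal_ass_ideal by (simp add: diass_ideal_def)

text \<open>Addition is commutative, so the additive subgroup \<open>I\<close> is normal and the
  theory of additive cosets applies.\<close>

sublocale I: abelian_subgroup I D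
  by (intro abelian_subgroupI3 additive_subgroupI submodule.axioms(1)[OF submodule_ass_ideal])
    unfold_locales

lemma ass_ideal_products:
  assumes "x \<in> I" "a \<in> carrier D"
  shows "x \<stileturn>\<^bsub>D\<^esub> a \<in> I" "a \<stileturn>\<^bsub>D\<^esub> x \<in> I"
  using assms diass_ideal_ass_ideal by (auto simp: diass_ideal_def)

section \<open>Cosets of \<open>I\<close> and the vector space \<open>Q\<close>\<close>

lemma carrier_Q: "carrier Q = q ` carrier D"
  by (auto simp: ass_quot_def ass_class_def A_RCOSETS_def')

lemma q_closed [simp, intro]: "a \<in> carrier D \<Longrightarrow> q a \<in> carrier Q"
  by (simp add: carrier_Q)

lemma mem_q: "a \<in> carrier D \<Longrightarrow> x \<in> q a \<Longrightarrow> x \<in> carrier D"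
  unfolding ass_class_def by (rule I.a_elemrcos_carrier)

lemma q_self: "a \<in> carrier D \<Longrightarrow> a \<in> q a"
  unfolding ass_class_def by (rule I.a_rcos_self)

lemma mem_q_diff: "a \<in> carrier D \<Longrightarrow> x \<in> q a \<Longrightarrow> x \<ominus>\<^bsub>D\<^esub> a \<in> I"
  unfolding ass_class_def a_minus_def by (rule I.a_rcos_module_imp)

lemma q_eqI:
  assumes "a \<in> carrier D" "b \<in> carrier D" "a \<ominus>\<^bsub>D\<^esub> b \<in> I"
  shows "q a = q b"
  using assms I.a_repr_independence'[of a b] I.a_rcos_module_rev[of b a]
  by (simp add: ass_class_def a_minus_def)

text \<open>The common source of well-definedness: two elements of a coset differ by an element of
  \<open>I\<close>, which \<open>f\<close> kills. Both actions and the transpose obtain the argument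
  of \<open>the_elem\<close> as a singleton from here.\<close>

lemma image_q:
  assumes W: "module K W" and f: "linear_map K D W f" and I: "\<And>x. x \<in> I \<Longrightarrow> f x = \<zero>\<^bsub>W\<^esub>"
    and a: "a \<in> carrier D"
  shows "f ` q a = {f a}"
proof -
  interpret W: module K W by fact
  have "f x = f a" if x: "x \<in> q a" for x
  proof -
    have xD: "x \<in> carrier D" using a x by (rule mem_q)
    note W_closed = linear_map_closed[OF f xD] linear_map_closed[OF f a]
    have "f x \<ominus>\<^bsub>W\<^esub> f a = f (x \<ominus>\<^bsub>D\<^esub> a)"
      by (rule linear_map_minus[OF module_D W f xD a, symmetric])
    also have "\<dots> = \<zero>\<^bsub>W\<^esub>"
      by (rule I[OF mem_q_diff[OF a x]])
    finally have "f x \<oplus>\<^bsub>W\<^esub> \<ominus>\<^bsub>W\<^esub> f a = \<zero>\<^bsub>W\<^esub>"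
      unfolding a_minus_def .
    \<comment> \<open>Inverses are unique, and \<open>f x\<close> has just been shown to be an
      inverse of the negative of \<open>f a\<close>.\<close>
    then have "\<ominus>\<^bsub>W\<^esub> (\<ominus>\<^bsub>W\<^esub> f a) = f x"
      using W_closed by (intro W.M.minus_equality) auto
    then show ?thesis using W_closed by simp
  qed
  then have "f ` q a = (\<lambda>_. f a) ` q a" by (rule image_cong[OF refl])
  \<comment> \<open>The coset contains \<open>a\<close>, so the image of the constant map is not
    empty.\<close>
  then show ?thesis using q_self[OF a] by auto
qed

lemma q_add: "a \<in> carrier D \<Longrightarrow> b \<in> carrier D \<Longrightarrow> q a \<oplus>\<^bsub>Q\<^esub> q b = q (a \<oplus>\<^bsub>D\<^esub> b)"
  by (simp add: ass_quot_def ass_class_def I.a_rcos_sum)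

lemma q_zero: "\<zero>\<^bsub>Q\<^esub> = q \<zero>\<^bsub>D\<^esub>"
  by (simp add: ass_quot_def ass_class_def I.a_subset)

text \<open>The definition takes a union of classes over all representatives. These classes coincide
  because \<open>I\<close> is closed under scalars, and there is at least one of them.\<close>

lemma q_smult:
  assumes r: "r \<in> carrier K" and a: "a \<in> carrier D"
  shows "r \<odot>\<^bsub>Q\<^esub> q a = q (r \<odot>\<^bsub>D\<^esub> a)"
proof -
  have "q (r \<odot>\<^bsub>D\<^esub> x) = q (r \<odot>\<^bsub>D\<^esub> a)" if x: "x \<in> q a" for x
  proof (rule q_eqI)
    have xD: "x \<in> carrier D" using a x by (rule mem_q)
    then have "r \<odot>\<^bsub>D\<^esub> x \<ominus>\<^bsub>D\<^esub> r \<odot>\<^bsub>D\<^esub> a = r \<odot>\<^bsub>D\<^esub> (x \<ominus>\<^bsub>D\<^esub> a)"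
      using r a by (simp add: a_minus_def smult_r_distr smult_r_minus)
    then show "r \<odot>\<^bsub>D\<^esub> x \<ominus>\<^bsub>D\<^esub> r \<odot>\<^bsub>D\<^esub> a \<in> I"
      using submoduleE(4)[OF submodule_ass_ideal r mem_q_diff[OF a x]] by simp
    show "r \<odot>\<^bsub>D\<^esub> x \<in> carrier D" "r \<odot>\<^bsub>D\<^esub> a \<in> carrier D" using r a xD by auto
  qed
  then have "(\<Union>x\<in>q a. q (r \<odot>\<^bsub>D\<^esub> x)) = (\<Union>x\<in>q a. q (r \<odot>\<^bsub>D\<^esub> a))"
    by (rule SUP_cong[OF refl])
  then show ?thesis using q_self[OF a] by (auto simp: ass_quot_def)
qed

text \<open>The difference is a generator of \<open>I\<close>. Hence the product of
  \<open>Q\<close>, written with \<open>\<stileturn>\<close>, serves \<open>\<turnstile>\<close> as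
  well.\<close>

lemma q_dleft_dright: "a \<in> carrier D \<Longrightarrow> b \<in> carrier D \<Longrightarrow> q (a \<turnstile>\<^bsub>D\<^esub> b) = q (a \<stileturn>\<^bsub>D\<^esub> b)"
  by (intro q_eqI[symmetric] ass_ideal_generator) auto

text \<open>Since \<open>q\<close> is onto and carries the operations of \<open>D\<close> to those
  of \<open>Q\<close>, every law descends.\<close>

lemma module_Q: "module K Q"
proof (rule moduleI[OF R.is_cring abelian_groupI])
  show "\<exists>Y\<in>carrier Q. Y \<oplus>\<^bsub>Q\<^esub> X = \<zero>\<^bsub>Q\<^esub>" if "X \<in> carrier Q" for X
  proof -
    obtain a where a: "a \<in> carrier D" "X = q a" using \<open>X \<in> carrier Q\<close> by (auto simp: carrier_Q)
    then have "q (\<ominus>\<^bsub>D\<^esub> a) \<oplus>\<^bsub>Q\<^esub> X = \<zero>\<^bsub>Q\<^esub>" by (simp add: q_add q_zero M.l_neg)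
    then show ?thesis using a by blast
  qed
qed (auto simp: carrier_Q q_add q_zero q_smult M.a_assoc M.a_comm M.a_lcomm smult_l_distr smult_r_distr
    smult_assoc1)

lemma q_linear: "linear_map K D Q q"
  by (rule linear_mapI) (auto simp: q_add q_smult)

text \<open>Linearity can be tested after composing with the linear surjection \<open>q\<close>;
  \<open>f\<close> is that composite.\<close>

lemma linear_map_from_Q:
  assumes f: "\<And>a. a \<in> carrier D \<Longrightarrow> g (q a) = f a" and lin: "linear_map K D W f"
  shows "linear_map K Q W g"
  by (rule linear_mapI)
    (auto simp: carrier_Q q_add q_smult f linear_map_add[OF lin] linear_map_smult[OF lin]
      linear_map_closed[OF lin])

section \<open>The associative product of \<open>Q\<close>\<close>

lemma q_mult:
  assumes a: "a \<in> carrier D" and b: "b \<in> carrier D"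
  shows "q a \<otimes>\<^bsub>Q\<^esub> q b = q (a \<stileturn>\<^bsub>D\<^esub> b)"
proof -
  \<comment> \<open>The representatives are exchanged one factor at a time: by bilinearity each
    exchange changes the product by \<open>x - a\<close> or \<open>y - b\<close> times an element of
    \<open>D\<close>, which lies in \<open>I\<close>.\<close>
  have 1: "q (x \<stileturn>\<^bsub>D\<^esub> y) = q (a \<stileturn>\<^bsub>D\<^esub> y)" if x: "x \<in> q a" and y: "y \<in> carrier D" for x y
  proof (rule q_eqI)
    have xD: "x \<in> carrier D" using a x by (rule mem_q)
    then show "x \<stileturn>\<^bsub>D\<^esub> y \<in> carrier D" "a \<stileturn>\<^bsub>D\<^esub> y \<in> carrier D" using a y by auto
    show "x \<stileturn>\<^bsub>D\<^esub> y \<ominus>\<^bsub>D\<^esub> a \<stileturn>\<^bsub>D\<^esub> y \<in> I"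
      using linear_map_minus[OF module_D module_D bilinear_map_left[OF dleft_bilinear y] xD a]
        ass_ideal_products(1)[OF mem_q_diff[OF a x] y] by simp
  qed
  have 2: "q (a \<stileturn>\<^bsub>D\<^esub> y) = q (a \<stileturn>\<^bsub>D\<^esub> b)" if y: "y \<in> q b" for y
  proof (rule q_eqI)
    have yD: "y \<in> carrier D" using b y by (rule mem_q)
    then show "a \<stileturn>\<^bsub>D\<^esub> y \<in> carrier D" "a \<stileturn>\<^bsub>D\<^esub> b \<in> carrier D" using a b by auto
    show "a \<stileturn>\<^bsub>D\<^esub> y \<ominus>\<^bsub>D\<^esub> a \<stileturn>\<^bsub>D\<^esub> b \<in> I"
      using linear_map_minus[OF module_D module_D bilinear_map_right[OF dleft_bilinear a] yD b]
        ass_ideal_products(2)[OF mem_q_diff[OF b y] a] by simp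
  qed
  have "q (x \<stileturn>\<^bsub>D\<^esub> y) = q (a \<stileturn>\<^bsub>D\<^esub> b)" if "x \<in> q a" "y \<in> q b" for x y
    by (rule trans[OF 1[OF that(1) mem_q[OF b that(2)]] 2[OF that(2)]])
  then have "(\<Union>x\<in>q a. \<Union>y\<in>q b. q (x \<stileturn>\<^bsub>D\<^esub> y)) = (\<Union>x\<in>q a. \<Union>y\<in>q b. q (a \<stileturn>\<^bsub>D\<^esub> b))"
    by (intro SUP_cong refl)
  then show ?thesis using q_self[OF a] q_self[OF b] by (auto simp: ass_quot_def)
qed

lemma assoc_algebra_Q: "assoc_algebra K Q"
proof (intro assoc_algebra.intro assoc_algebra_axioms.intro module_Q)
  show "bilinear_map K Q Q Q (mult Q)"
    unfolding bilinear_map_def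
  proof (intro conjI ballI)
    fix X assume "X \<in> carrier Q"
    then obtain a where a: "a \<in> carrier D" "X = q a" by (auto simp: carrier_Q)
    show "linear_map K Q Q (mult Q X)"
      \<comment> \<open>Composed with \<open>q\<close>, multiplication by \<open>q a\<close> becomes
        multiplication by \<open>a\<close> in \<open>D\<close> followed by \<open>q\<close>.\<close>
      by (rule linear_map_from_Q[OF _ linear_map_compose[OF
            bilinear_map_right[OF dleft_bilinear a(1)] q_linear]])
        (simp add: a q_mult)
    show "linear_map K Q Q (\<lambda>Y. Y \<otimes>\<^bsub>Q\<^esub> X)"
      by (rule linear_map_from_Q[OF _ linear_map_compose[OF
            bilinear_map_left[OF dleft_bilinear a(1)] q_linear]])
        (simp add: a q_mult)
  qed
qed (auto simp: carrier_Q q_mult dleft_dleft)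

text \<open>These are the two sides on which a class acts: on the left through
  \<open>\<turnstile>\<close>, on the right through \<open>\<stileturn>\<close>.\<close>

lemma ass_ideal_annihilates:
  assumes "x \<in> I" "b \<in> carrier D"
  shows "x \<turnstile>\<^bsub>D\<^esub> b = \<zero>\<^bsub>D\<^esub>" "b \<stileturn>\<^bsub>D\<^esub> x = \<zero>\<^bsub>D\<^esub>"
proof -
  let ?J = "{x \<in> carrier D. \<forall>b\<in>carrier D. x \<turnstile>\<^bsub>D\<^esub> b = \<zero>\<^bsub>D\<^esub> \<and> b \<stileturn>\<^bsub>D\<^esub> x = \<zero>\<^bsub>D\<^esub>}"
  note lin = bilinear_map_left[OF dright_bilinear] bilinear_map_right[OF dleft_bilinear]
  note uminus = linear_map_uminus[OF module_D module_D lin(1)]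
    linear_map_uminus[OF module_D module_D lin(2)]
  have "I \<subseteq> ?J"
  proof (rule ass_ideal_least)
    show "diass_ideal K D ?J"
      unfolding diass_ideal_def
    proof
      show "submodule ?J K D"
        by (rule submoduleI)
          (auto simp: uminus linear_map_add[OF lin(1)] linear_map_add[OF lin(2)]
            linear_map_smult[OF lin(1)] linear_map_smult[OF lin(2)])
      \<comment> \<open>Two of the products are zero by assumption. For the others the axioms bring
        \<open>x\<close> next to a factor that it kills, as in \<open>(x \<stileturn> a)
        \<turnstile> b = x \<turnstile> (a \<turnstile> b)\<close> and \<open>b \<stileturn> (a
        \<turnstile> x) = b \<stileturn> (a \<stileturn> x)\<close>.\<close>
      have "x \<stileturn>\<^bsub>D\<^esub> a \<in> ?J \<and> a \<stileturn>\<^bsub>D\<^esub> x \<in> ?J \<and> x \<turnstile>\<^bsub>D\<^esub> a \<in> ?J \<and> a \<turnstile>\<^bsub>D\<^esub> x \<in> ?J"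
        if x: "x \<in> ?J" and a: "a \<in> carrier D" for x a
        using x a
        by (auto simp: dleft_then_dright dright_dright dleft_dright[symmetric]
            dleft_dleft[symmetric])
      then show "\<forall>x\<in>?J. \<forall>a\<in>carrier D.
          x \<stileturn>\<^bsub>D\<^esub> a \<in> ?J \<and> a \<stileturn>\<^bsub>D\<^esub> x \<in> ?J \<and> x \<turnstile>\<^bsub>D\<^esub> a \<in> ?J \<and> a \<turnstile>\<^bsub>D\<^esub> x \<in> ?J"
        by blast
    qed
  \<comment> \<open>A generator acts as zero by exactly the two axioms that identify the products
    \<open>\<stileturn>\<close> and \<open>\<turnstile>\<close> inside the left factor of
    \<open>\<turnstile>\<close> or the right factor of \<open>\<stileturn>\<close>.\<close>
  qed (auto simp: a_minus_def linear_map_add[OF lin(1)] linear_map_add[OF lin(2)] uminus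
      dleft_then_dright dleft_dright M.r_neg)
  then show "x \<turnstile>\<^bsub>D\<^esub> b = \<zero>\<^bsub>D\<^esub>" "b \<stileturn>\<^bsub>D\<^esub> x = \<zero>\<^bsub>D\<^esub>" using assms by blast+
qed

section \<open>The bimodule \<open>D\<close> over \<open>Q\<close> and its averaging map\<close>

lemma G_obj_simps [simp]:
  "alg (G_obj K D) = Q" "carrier (bim (G_obj K D)) = carrier D"
  "add (bim (G_obj K D)) = add D" "zero (bim (G_obj K D)) = zero D"
  "smult (bim (G_obj K D)) = smult D" "avg (G_obj K D) = q"
  by (simp_all add: G_obj_def module.truncate_def)

lemma linear_map_bim_G_obj [simp]:
  "linear_map K (bim (G_obj K D)) W f = linear_map K D W f"
  "linear_map K V (bim (G_obj K D)) g = linear_map K V D g"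
  by (simp_all add: linear_map_def)

text \<open>The map sending \<open>x\<close> to \<open>x \<turnstile> b\<close> is linear and
  vanishes on \<open>I\<close>, so \<open>image_q\<close> evaluates \<open>the_elem\<close>.\<close>

lemma lact_q:
  assumes "a \<in> carrier D" "b \<in> carrier D"
  shows "lact (G_obj K D) (q a) b = a \<turnstile>\<^bsub>D\<^esub> b"
  using image_q[OF module_D bilinear_map_left[OF dright_bilinear assms(2)] _ assms(1)]
  by (simp add: G_obj_def ass_ideal_annihilates assms(2))

lemma ract_q:
  assumes "a \<in> carrier D" "b \<in> carrier D"
  shows "ract (G_obj K D) b (q a) = b \<stileturn>\<^bsub>D\<^esub> a"
  using image_q[OF module_D bilinear_map_right[OF dleft_bilinear assms(2)] _ assms(1)]
  by (simp add: G_obj_def ass_ideal_annihilates assms(2))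

text \<open>On representatives the bimodule laws are diassociative axioms: \<open>(a \<stileturn> b)
  \<turnstile> u = a \<turnstile> (b \<turnstile> u)\<close>, \<open>(a \<turnstile> u) \<stileturn>
  b = a \<turnstile> (u \<stileturn> b)\<close> and associativity of
  \<open>\<stileturn>\<close>.\<close>

lemma assoc_bimodule_G_obj:
  "assoc_bimodule K Q (bim (G_obj K D)) (lact (G_obj K D)) (ract (G_obj K D))"
proof (intro assoc_bimodule.intro assoc_bimodule_axioms.intro assoc_algebra_Q)
  show "module K (bim (G_obj K D))"
    by (rule module_transfer[OF module_D]) simp_all
  have l1: "linear_map K D D (lact (G_obj K D) (q a))" if "a \<in> carrier D" for a
    by (rule linear_map_cong[OF module_D bilinear_map_right[OF dright_bilinear that]])
      (simp add: lact_q that)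
  have l2: "linear_map K Q D (\<lambda>X. lact (G_obj K D) X b)" if "b \<in> carrier D" for b
    by (rule linear_map_from_Q[OF _ bilinear_map_left[OF dright_bilinear that]])
      (simp add: lact_q that)
  show "bilinear_map K Q (bim (G_obj K D)) (bim (G_obj K D)) (lact (G_obj K D))"
    using l1 l2 by (auto simp: bilinear_map_def carrier_Q)
  have r1: "linear_map K D D (\<lambda>b. ract (G_obj K D) b (q a))" if "a \<in> carrier D" for a
    by (rule linear_map_cong[OF module_D bilinear_map_left[OF dleft_bilinear that]])
      (simp add: ract_q that)
  have r2: "linear_map K Q D (ract (G_obj K D) b)" if "b \<in> carrier D" for b
    by (rule linear_map_from_Q[OF _ bilinear_map_right[OF dleft_bilinear that]])
      (simp add: ract_q that)
  show "bilinear_map K (bim (G_obj K D)) Q (bim (G_obj K D)) (ract (G_obj K D))"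
    using r1 r2 by (auto simp: bilinear_map_def carrier_Q)
qed (auto simp: carrier_Q q_mult lact_q ract_q dleft_then_dright dright_dright dright_dleft
    dleft_dleft)

text \<open>Both averaging identities say that \<open>q\<close> is multiplicative, once for each
  product of \<open>D\<close>.\<close>

lemma rel_avg_algebra_G_obj: "rel_avg_algebra K (G_obj K D)"
  using assoc_bimodule_G_obj q_linear
  by (auto simp: rel_avg_algebra_def q_mult lact_q ract_q q_dleft_dright)

end


section \<open>The diassociative algebra of a relative averaging algebra\<close>

lemma F_obj_simps [simp]:
  "carrier (F_obj R) = carrier (bim R)" "add (F_obj R) = add (bim R)"
  "zero (F_obj R) = zero (bim R)" "smult (F_obj R) = smult (bim R)"
  "u \<stileturn>\<^bsub>F_obj R\<^esub> v = ract R u (avg R v)" "u \<turnstile>\<^bsub>F_obj R\<^esub> v = lact R (avg R u) v"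
  by (simp_all add: F_obj_def)

lemma linear_map_F_obj [simp]:
  "linear_map K (F_obj R) W f = linear_map K (bim R) W f"
  "linear_map K V (F_obj R) g = linear_map K V (bim R) g"
  by (simp_all add: linear_map_def)

text \<open>The averaging identities are turned around, so that as rewrite rules they replace an
  action under \<open>avg\<close> by a product in the algebra.\<close>

lemma rel_avg_algebraD:
  assumes "rel_avg_algebra K R"
  shows "assoc_bimodule K (alg R) (bim R) (lact R) (ract R)"
    and "linear_map K (bim R) (alg R) (avg R)"
    and "\<And>u v. \<lbrakk>u \<in> carrier (bim R); v \<in> carrier (bim R)\<rbrakk> \<Longrightarrow>
      avg R (lact R (avg R u) v) = avg R u \<otimes>\<^bsub>alg R\<^esub> avg R v"
    and "\<And>u v. \<lbrakk>u \<in> carrier (bim R); v \<in> carrier (bim R)\<rbrakk> \<Longrightarrow>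
      avg R (ract R u (avg R v)) = avg R u \<otimes>\<^bsub>alg R\<^esub> avg R v"
  using assms unfolding rel_avg_algebra_def by metis+

text \<open>Once \<open>P\<close> of either product is rewritten as \<open>P u\<close> times
  \<open>P v\<close>, every axiom is an identity or one of the three bimodule laws.\<close>

lemma diassociative_algebra_F_obj:
  assumes "rel_avg_algebra K R"
  shows "diassociative_algebra K (F_obj R)"
proof -
  interpret B: assoc_bimodule K "alg R" "bim R" "lact R" "ract R"
    by (rule rel_avg_algebraD(1)[OF assms])
  note P = rel_avg_algebraD(2)[OF assms] and mult = rel_avg_algebraD(3,4)[OF assms]
  note closed = linear_map_closed[OF P]
  show ?thesis
  proof (intro diassociative_algebra.intro diassociative_algebra_axioms.intro)
    show "module K (F_obj R)"
      by (rule module_transfer[OF B.M.module_axioms]) simp_all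
    show "bilinear_map K (F_obj R) (F_obj R) (F_obj R) (dleft (F_obj R))"
      \<comment> \<open>One argument enters through \<open>P\<close> and needs a composite of linear
        maps; the other enters the action directly.\<close>
      using linear_map_compose[OF P bilinear_map_right[OF B.r_bilinear]]
        bilinear_map_left[OF B.r_bilinear closed]
      by (simp add: bilinear_map_def F_obj_def[THEN arg_cong[of _ _ dleft]])
    show "bilinear_map K (F_obj R) (F_obj R) (F_obj R) (dright (F_obj R))"
      using linear_map_compose[OF P bilinear_map_left[OF B.l_bilinear]]
        bilinear_map_right[OF B.l_bilinear closed]
      by (simp add: bilinear_map_def F_obj_def[THEN arg_cong[of _ _ dright]])
  qed (simp_all add: mult closed B.l_l B.l_r B.r_r)
qed

lemma ravg_homD:
  assumes "g \<in> ravg_hom K R R'"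
  shows "fst g \<in> carrier (alg R) \<rightarrow>\<^sub>E carrier (alg R')" "linear_map K (alg R) (alg R') (fst g)"
    and "\<And>a b. \<lbrakk>a \<in> carrier (alg R); b \<in> carrier (alg R)\<rbrakk> \<Longrightarrow>
      fst g (a \<otimes>\<^bsub>alg R\<^esub> b) = fst g a \<otimes>\<^bsub>alg R'\<^esub> fst g b"
    and "snd g \<in> carrier (bim R) \<rightarrow>\<^sub>E carrier (bim R')" "linear_map K (bim R) (bim R') (snd g)"
    and "\<And>a u. \<lbrakk>a \<in> carrier (alg R); u \<in> carrier (bim R)\<rbrakk> \<Longrightarrow>
      snd g (lact R a u) = lact R' (fst g a) (snd g u)"
    and "\<And>a u. \<lbrakk>a \<in> carrier (alg R); u \<in> carrier (bim R)\<rbrakk> \<Longrightarrow>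
      snd g (ract R u a) = ract R' (snd g u) (fst g a)"
    and "\<And>u. u \<in> carrier (bim R) \<Longrightarrow> fst g (avg R u) = avg R' (snd g u)"
  using assms by (auto simp: ravg_hom_def)

lemma diass_homD:
  assumes "h \<in> diass_hom K D D'"
  shows "h \<in> carrier D \<rightarrow>\<^sub>E carrier D'" "linear_map K D D' h"
    and "\<And>a b. \<lbrakk>a \<in> carrier D; b \<in> carrier D\<rbrakk> \<Longrightarrow> h (a \<stileturn>\<^bsub>D\<^esub> b) = h a \<stileturn>\<^bsub>D'\<^esub> h b"
    and "\<And>a b. \<lbrakk>a \<in> carrier D; b \<in> carrier D\<rbrakk> \<Longrightarrow> h (a \<turnstile>\<^bsub>D\<^esub> b) = h a \<turnstile>\<^bsub>D'\<^esub> h b"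
  using assms by (auto simp: diass_hom_def)

text \<open>The condition \<open>\<phi> \<circ> P = P' \<circ> \<psi>\<close> turns compatibility
  with the actions into \<open>\<psi> (u \<cdot> P v) = \<psi> u \<cdot> P' (\<psi> v)\<close>, and
  likewise on the left.\<close>

lemma F_mor_diass_hom:
  assumes R: "rel_avg_algebra K R" and g: "g \<in> ravg_hom K R R'"
  shows "F_mor R R' g \<in> diass_hom K (F_obj R) (F_obj R')"
proof -
  have "linear_map K (bim R) (alg R) (avg R)"
    by (rule rel_avg_algebraD(2)[OF R])
  then show ?thesis
    using ravg_homD[OF g] by (simp add: diass_hom_def F_mor_def linear_map_closed)
qed


section \<open>The adjunction bijection\<close>

text \<open>The first component is the map induced on the quotient by \<open>P \<circ> h\<close>;
  its restriction makes it extensional, as \<open>ravg_hom\<close> demands.\<close>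

definition ravg_transpose ::
  "('k, 'e) ring_scheme \<Rightarrow> ('k, 'd) diass \<Rightarrow> ('k, 'm, 'a) ravg \<Rightarrow> ('d \<Rightarrow> 'm) \<Rightarrow>
   ('d set \<Rightarrow> 'a) \<times> ('d \<Rightarrow> 'm)"
  where "ravg_transpose K D R h =
    (\<lambda>X\<in>carrier (ass_quot K D). the_elem ((\<lambda>a. avg R (h a)) ` X), h)"

lemma snd_ravg_transpose [simp]: "snd (ravg_transpose K D R h) = h"
  by (simp add: ravg_transpose_def)

lemma fst_ravg_transpose_extensional:
  "fst (ravg_transpose K D R h) \<in> extensional (carrier (ass_quot K D))"
  by (simp add: ravg_transpose_def)

context diass_quotient
begin

lemma linear_map_avg_diass_hom:
  assumes R: "rel_avg_algebra K R" and h: "h \<in> diass_hom K D (F_obj R)"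
  shows "linear_map K D (alg R) (\<lambda>a. avg R (h a))"
  using linear_map_compose[OF _ rel_avg_algebraD(2)[OF R]] diass_homD(2)[OF h] by simp

text \<open>Here the averaging identities of \<open>R\<close> enter: \<open>P\<close> does not
  distinguish the two products of \<open>F_obj R\<close>.\<close>

lemma avg_diass_hom_mult:
  assumes R: "rel_avg_algebra K R" and h: "h \<in> diass_hom K D (F_obj R)"
    and ab: "a \<in> carrier D" "b \<in> carrier D"
  shows "avg R (h (a \<stileturn>\<^bsub>D\<^esub> b)) = avg R (h a) \<otimes>\<^bsub>alg R\<^esub> avg R (h b)"
    and "avg R (h (a \<turnstile>\<^bsub>D\<^esub> b)) = avg R (h a) \<otimes>\<^bsub>alg R\<^esub> avg R (h b)"
  using rel_avg_algebraD(3,4)[OF R] diass_homD[OF h] ab by (auto simp: PiE_iff)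

lemma avg_diass_hom_ass_ideal:
  assumes R: "rel_avg_algebra K R" and h: "h \<in> diass_hom K D (F_obj R)" and x: "x \<in> I"
  shows "avg R (h x) = \<zero>\<^bsub>alg R\<^esub>"
proof -
  interpret B: assoc_bimodule K "alg R" "bim R" "lact R" "ract R"
    by (rule rel_avg_algebraD(1)[OF R])
  let ?f = "\<lambda>a. avg R (h a)"
  have f: "linear_map K D (alg R) ?f" using R h by (rule linear_map_avg_diass_hom)
  note mult = avg_diass_hom_mult[OF R h]
  note m = module_D B.A.module_axioms
  note zero = linear_map_zero[OF m f]
  \<comment> \<open>Bilinearity makes zero absorbing, which lets the kernel \<open>?J\<close> absorb
    products on both sides.\<close>
  have mult0: "y \<otimes>\<^bsub>alg R\<^esub> \<zero>\<^bsub>alg R\<^esub> = \<zero>\<^bsub>alg R\<^esub>" "\<zero>\<^bsub>alg R\<^esub> \<otimes>\<^bsub>alg R\<^esub> y = \<zero>\<^bsub>alg R\<^esub>"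
    if "y \<in> carrier (alg R)" for y
    using linear_map_zero[OF m(2) m(2) bilinear_map_right[OF B.A.mult_bilinear that]]
      linear_map_zero[OF m(2) m(2) bilinear_map_left[OF B.A.mult_bilinear that]] by auto
  let ?J = "{a \<in> carrier D. ?f a = \<zero>\<^bsub>alg R\<^esub>}"
  have "I \<subseteq> ?J"
  proof (rule ass_ideal_least)
    have "submodule ?J K D"
      by (rule submoduleI)
        (auto simp: zero linear_map_add[OF f] linear_map_smult[OF f] linear_map_uminus[OF m f])
    then show "diass_ideal K D ?J"
      by (auto simp: diass_ideal_def mult mult0 linear_map_closed[OF f])
    show "a \<stileturn>\<^bsub>D\<^esub> b \<ominus>\<^bsub>D\<^esub> a \<turnstile>\<^bsub>D\<^esub> b \<in> ?J" if "a \<in> carrier D" "b \<in> carrier D" for a b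
      using that bilinear_map_closed[OF B.A.mult_bilinear] linear_map_closed[OF f]
      by (simp add: linear_map_minus[OF m f] mult a_minus_def[of "alg R"] B.A.r_neg)
  qed
  then show ?thesis using x by blast
qed

lemma ravg_transpose_q:
  assumes R: "rel_avg_algebra K R" and h: "h \<in> diass_hom K D (F_obj R)" and a: "a \<in> carrier D"
  shows "fst (ravg_transpose K D R h) (q a) = avg R (h a)"
proof -
  interpret B: assoc_bimodule K "alg R" "bim R" "lact R" "ract R"
    by (rule rel_avg_algebraD(1)[OF R])
  show ?thesis
    using image_q[OF B.A.module_axioms linear_map_avg_diass_hom[OF R h]
        avg_diass_hom_ass_ideal[OF R h] a] a
    by (simp add: ravg_transpose_def)
qed

text \<open>On classes the action conditions reduce to \<open>h\<close> preserving the products,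
  because those of \<open>F_obj R\<close> are actions of \<open>P (h a)\<close>, the image of
  \<open>q a\<close>.\<close>

lemma ravg_transpose_ravg_hom:
  assumes R: "rel_avg_algebra K R" and h: "h \<in> diass_hom K D (F_obj R)"
  shows "ravg_transpose K D R h \<in> ravg_hom K (G_obj K D) R"
proof -
  let ?\<phi> = "fst (ravg_transpose K D R h)"
  note t = ravg_transpose_q[OF R h]
  have lin: "linear_map K Q (alg R) ?\<phi>"
    by (rule linear_map_from_Q[OF t linear_map_avg_diass_hom[OF R h]])
  then have "?\<phi> \<in> carrier Q \<rightarrow>\<^sub>E carrier (alg R)"
    using fst_ravg_transpose_extensional by (auto simp: PiE_def linear_map_def)
  moreover have "?\<phi> (X \<otimes>\<^bsub>Q\<^esub> Y) = ?\<phi> X \<otimes>\<^bsub>alg R\<^esub> ?\<phi> Y" if "X \<in> carrier Q" "Y \<in> carrier Q" for X Y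
    using that by (auto simp: carrier_Q q_mult t avg_diass_hom_mult[OF R h])
  moreover have "h (lact (G_obj K D) X u) = lact R (?\<phi> X) (h u)"
      "h (ract (G_obj K D) u X) = ract R (h u) (?\<phi> X)" if "X \<in> carrier Q" "u \<in> carrier D" for X u
    using that diass_homD[OF h] by (auto simp: carrier_Q t lact_q ract_q)
  ultimately have "(?\<phi>, h) \<in> ravg_hom K (G_obj K D) R"
    using lin diass_homD(1,2)[OF h] t by (simp add: ravg_hom_def)
  then show ?thesis by (simp add: ravg_transpose_def)
qed

text \<open>Each product in \<open>D\<close> is an action of a class, for instance of
  \<open>q b\<close> on \<open>a\<close> from the right, and the first component sends
  \<open>q b\<close> to \<open>P\<close> of the image of \<open>b\<close>.\<close>

lemma snd_ravg_hom_G_obj: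
  assumes g: "g \<in> ravg_hom K (G_obj K D) R"
  shows "snd g \<in> diass_hom K D (F_obj R)"
proof -
  have "snd g (a \<stileturn>\<^bsub>D\<^esub> b) = ract R (snd g a) (avg R (snd g b))"
    "snd g (a \<turnstile>\<^bsub>D\<^esub> b) = lact R (avg R (snd g a)) (snd g b)"
    if "a \<in> carrier D" "b \<in> carrier D" for a b
    using ravg_homD(6)[OF g, of "q a" b] ravg_homD(7)[OF g, of "q b" a]
      ravg_homD(8)[OF g, of a] ravg_homD(8)[OF g, of b] that
    by (simp_all add: lact_q ract_q)
  then show ?thesis
    using ravg_homD(4,5)[OF g] by (simp add: diass_hom_def)
qed

lemma extensional_Q_eqI:
  assumes "f \<in> extensional (carrier Q)" "g \<in> extensional (carrier Q)"
    and "\<And>a. a \<in> carrier D \<Longrightarrow> f (q a) = g (q a)"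
  shows "f = g"
  using assms by (intro extensionalityI[of f "carrier Q" g]) (auto simp: carrier_Q)

lemma ravg_transpose_snd:
  assumes R: "rel_avg_algebra K R" and g: "g \<in> ravg_hom K (G_obj K D) R"
  shows "ravg_transpose K D R (snd g) = g"
proof (rule prod_eqI)
  show "fst (ravg_transpose K D R (snd g)) = fst g"
    using ravg_homD(1,8)[OF g] ravg_transpose_q[OF R snd_ravg_hom_G_obj[OF g]]
    by (intro extensional_Q_eqI fst_ravg_transpose_extensional) (auto simp: PiE_def)
qed simp

lemma bij_betw_ravg_transpose:
  assumes R: "rel_avg_algebra K R"
  shows "bij_betw (ravg_transpose K D R) (diass_hom K D (F_obj R)) (ravg_hom K (G_obj K D) R)"
  \<comment> \<open>The inverse forgets the map on algebras, which \<open>ravg_transpose_snd\<close>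
    recovers.\<close>
  by (rule bij_betw_byWitness[of _ snd])
    (simp_all add: image_subset_iff ravg_transpose_snd[OF R] snd_ravg_hom_G_obj
      ravg_transpose_ravg_hom[OF R])

text \<open>The operations of \<open>F_obj (G_obj K D)\<close> agree with those of \<open>D\<close>
  on the carrier, though possibly not outside it, so morphisms are compared instead of records. In
  effect the unit of the adjunction is the identity.\<close>

lemma diass_hom_F_obj_G_obj: "diass_hom K D' (F_obj (G_obj K D)) = diass_hom K D' D"
  by (auto simp: diass_hom_def lact_q ract_q PiE_iff)

end

text \<open>A left adjoint sends an arrow to the transpose of its composite with the unit, here the
  identity. Thus \<open>G_mor\<close> inherits its well-definedness from the transpose.\<close>

lemma G_mor_transpose: "G_mor K D D' = ravg_transpose K D (G_obj K D')"
  by (simp add: fun_eq_iff G_mor_def ravg_transpose_def G_obj_def)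

lemma G_mor_ravg_hom:
  assumes "diassociative_algebra K D" "diassociative_algebra K D'" "f \<in> diass_hom K D D'"
  shows "G_mor K D D' f \<in> ravg_hom K (G_obj K D) (G_obj K D')"
    and "a \<in> carrier D \<Longrightarrow> fst (G_mor K D D' f) (ass_class K D a) = ass_class K D' (f a)"
proof -
  interpret D: diass_quotient K D using assms(1) by (rule diass_quotient.intro)
  interpret D': diass_quotient K D' using assms(2) by (rule diass_quotient.intro)
  have f: "f \<in> diass_hom K D (F_obj (G_obj K D'))"
    using assms(3) by (simp add: D'.diass_hom_F_obj_G_obj)
  show "G_mor K D D' f \<in> ravg_hom K (G_obj K D) (G_obj K D')"
    unfolding G_mor_transpose by (rule D.ravg_transpose_ravg_hom[OF D'.rel_avg_algebra_G_obj f])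
  show "a \<in> carrier D \<Longrightarrow> fst (G_mor K D D' f) (ass_class K D a) = ass_class K D' (f a)"
    unfolding G_mor_transpose
    by (subst D.ravg_transpose_q[OF D'.rel_avg_algebra_G_obj f]) auto
qed

lemma diass_comp_diass_hom:
  assumes "diassociative_algebra K D" "f \<in> diass_hom K D D'" "g \<in> diass_hom K D' D''"
  shows "diass_comp D g f \<in> diass_hom K D D''"
proof -
  interpret D: diass_quotient K D using assms(1) by (rule diass_quotient.intro)
  have f: "f a \<in> carrier D'" if "a \<in> carrier D" for a
    using diass_homD(1)[OF assms(2)] that by auto
  have "linear_map K D D'' (compose (carrier D) g f)"
    by (rule linear_map_cong[OF D.module_D
          linear_map_compose[OF diass_homD(2)[OF assms(2)] diass_homD(2)[OF assms(3)]]])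
      (simp add: compose_eq)
  then show ?thesis
    using diass_homD[OF assms(2)] diass_homD[OF assms(3)]
    by (auto simp: diass_hom_def diass_comp_def compose_def f PiE_iff)
qed

lemma ravg_comp_ravg_hom:
  assumes "rel_avg_algebra K R" "f \<in> ravg_hom K R R'" "g \<in> ravg_hom K R' R''"
  shows "ravg_comp R g f \<in> ravg_hom K R R''"
proof -
  interpret B: assoc_bimodule K "alg R" "bim R" "lact R" "ract R"
    by (rule rel_avg_algebraD(1)[OF assms(1)])
  have P: "avg R u \<in> carrier (alg R)" if "u \<in> carrier (bim R)" for u
    using that by (rule linear_map_closed[OF rel_avg_algebraD(2)[OF assms(1)]])
  note f = ravg_homD[OF assms(2)] and g = ravg_homD[OF assms(3)]
  have f1: "fst f a \<in> carrier (alg R')" if "a \<in> carrier (alg R)" for a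
    using f(1) that by auto
  have f2: "snd f u \<in> carrier (bim R')" if "u \<in> carrier (bim R)" for u
    using f(4) that by auto
  have lin1: "linear_map K (alg R) (alg R'') (compose (carrier (alg R)) (fst g) (fst f))"
    by (rule linear_map_cong[OF B.A.module_axioms linear_map_compose[OF f(2) g(2)]])
      (simp add: compose_eq)
  have lin2: "linear_map K (bim R) (bim R'') (compose (carrier (bim R)) (snd g) (snd f))"
    by (rule linear_map_cong[OF B.M.module_axioms linear_map_compose[OF f(5) g(5)]])
      (simp add: compose_eq)
  \<comment> \<open>\<open>compose\<close> evaluates only on the carrier, so products and actions
    must be known to stay there.\<close>
  note closed = bilinear_map_closed[OF B.A.mult_bilinear] bilinear_map_closed[OF B.l_bilinear]
    bilinear_map_closed[OF B.r_bilinear]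
  have "compose (carrier (alg R)) (fst g) (fst f) \<in> carrier (alg R) \<rightarrow>\<^sub>E carrier (alg R'')"
    "compose (carrier (bim R)) (snd g) (snd f) \<in> carrier (bim R) \<rightarrow>\<^sub>E carrier (bim R'')"
    using f1 f2 g(1,4) by (auto simp: compose_def PiE_iff)
  then show ?thesis
    using lin1 lin2
    by (auto simp: ravg_hom_def ravg_comp_def compose_eq f1 f2 f g P closed)
qed

text \<open>The second components agree by definition. At \<open>q a\<close> the first ones are
  \<open>P'\<close> of \<open>snd g (h (f a))\<close> and \<open>fst g\<close> of
  \<open>P (h (f a))\<close>, equal because \<open>g\<close> commutes with the averaging
  maps.\<close>

lemma ravg_transpose_natural:
  assumes D: "diassociative_algebra K D" and D': "diassociative_algebra K D'"
    and R: "rel_avg_algebra K R" and R': "rel_avg_algebra K R'"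
    and f: "f \<in> diass_hom K D' D" and g: "g \<in> ravg_hom K R R'"
    and h: "h \<in> diass_hom K D (F_obj R)"
  shows "ravg_transpose K D' R' (diass_comp D' (diass_comp D (F_mor R R' g) h) f) =
    ravg_comp (G_obj K D') (ravg_comp (G_obj K D) g (ravg_transpose K D R h)) (G_mor K D' D f)"
    (is "ravg_transpose K D' R' ?k = ?r")
proof (rule prod_eqI)
  interpret D: diass_quotient K D using D by (rule diass_quotient.intro)
  interpret D': diass_quotient K D' using D' by (rule diass_quotient.intro)
  have k: "?k \<in> diass_hom K D' (F_obj R')"
    by (intro diass_comp_diass_hom[OF D' f] diass_comp_diass_hom[OF D h] F_mor_diass_hom[OF R g])
  have fD: "f a \<in> carrier D" if "a \<in> carrier D'" for a
    using diass_homD(1)[OF f] that by auto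
  have hR: "h a \<in> carrier (bim R)" if "a \<in> carrier D" for a
    using diass_homD(1)[OF h] that by auto
  show "fst (ravg_transpose K D' R' ?k) = fst ?r"
  proof (rule D'.extensional_Q_eqI)
    fix a assume a: "a \<in> carrier D'"
    have "fst (ravg_transpose K D' R' ?k) (D'.q a) = avg R' (?k a)"
      by (rule D'.ravg_transpose_q[OF R' k a])
    also have "\<dots> = fst ?r (D'.q a)"
      using a ravg_homD(8)[OF g hR[OF fD]]
      by (simp add: D.ravg_transpose_q[OF R h] ravg_comp_def
          G_mor_ravg_hom(2)[OF D' D f] compose_eq diass_comp_def F_mor_def fD)
    finally show "fst (ravg_transpose K D' R' ?k) (D'.q a) = fst ?r (D'.q a)" .
  qed (simp_all add: fst_ravg_transpose_extensional ravg_comp_def)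
  show "snd (ravg_transpose K D' R' ?k) = snd ?r"
    by (simp add: ravg_comp_def diass_comp_def F_mor_def G_mor_def)
qed


section \<open>The categories and functors\<close>

lemma compose_restrict_id_right:
  "f \<in> A \<rightarrow>\<^sub>E B \<Longrightarrow> compose A f (\<lambda>x\<in>A. x) = f"
  by (rule compose_Id) (auto simp: PiE_def)

lemma compose_restrict_id_left:
  "f \<in> A \<rightarrow>\<^sub>E B \<Longrightarrow> compose A (\<lambda>x\<in>B. x) f = f"
  by (rule Id_compose) (auto simp: PiE_def)

lemma id_diass_hom:
  assumes "diassociative_algebra K D"
  shows "(\<lambda>x\<in>carrier D. x) \<in> diass_hom K D D"
proof -
  interpret D: diass_quotient K D using assms by (rule diass_quotient.intro)
  have "linear_map K D D (\<lambda>x\<in>carrier D. x)"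
    by (rule linear_map_cong[OF D.module_D linear_map_id]) simp
  then show ?thesis by (auto simp: diass_hom_def)
qed

lemma diass_comp_id:
  assumes "f \<in> diass_hom K D D'"
  shows "diass_comp D f (\<lambda>x\<in>carrier D. x) = f" "diass_comp D (\<lambda>x\<in>carrier D'. x) f = f"
  using diass_homD(1)[OF assms]
  by (simp_all add: diass_comp_def compose_restrict_id_left compose_restrict_id_right)

lemma diass_comp_assoc:
  assumes "f \<in> diass_hom K D D'"
  shows "diass_comp D (diass_comp D' h g) f = diass_comp D h (diass_comp D g f)"
  using compose_assoc[of f "carrier D" "carrier D'" h g] diass_homD(1)[OF assms]
  by (auto simp: diass_comp_def PiE_def)

lemma category_Diass: "category (Diass K)"
  by (auto simp: category_def Diass_def diass_comp_diass_hom id_diass_hom diass_comp_id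
      intro: diass_comp_assoc)

lemma id_ravg_hom:
  assumes R: "rel_avg_algebra K R"
  shows "(\<lambda>a\<in>carrier (alg R). a, \<lambda>u\<in>carrier (bim R). u) \<in> ravg_hom K R R"
proof -
  interpret B: assoc_bimodule K "alg R" "bim R" "lact R" "ract R"
    by (rule rel_avg_algebraD(1)[OF R])
  have "linear_map K (alg R) (alg R) (\<lambda>a\<in>carrier (alg R). a)"
    by (rule linear_map_cong[OF B.A.module_axioms linear_map_id]) simp
  moreover have "linear_map K (bim R) (bim R) (\<lambda>u\<in>carrier (bim R). u)"
    by (rule linear_map_cong[OF B.M.module_axioms linear_map_id]) simp
  ultimately show ?thesis
    by (auto simp: ravg_hom_def linear_map_closed[OF rel_avg_algebraD(2)[OF R]]
        bilinear_map_closed[OF B.A.mult_bilinear] bilinear_map_closed[OF B.l_bilinear]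
        bilinear_map_closed[OF B.r_bilinear])
qed

lemma ravg_comp_id:
  assumes "f \<in> ravg_hom K R R'"
  shows "ravg_comp R f (\<lambda>a\<in>carrier (alg R). a, \<lambda>u\<in>carrier (bim R). u) = f"
    and "ravg_comp R (\<lambda>a\<in>carrier (alg R'). a, \<lambda>u\<in>carrier (bim R'). u) f = f"
  using ravg_homD(1,4)[OF assms]
  by (simp_all add: ravg_comp_def compose_restrict_id_left compose_restrict_id_right)

lemma ravg_comp_assoc:
  assumes "f \<in> ravg_hom K R R'"
  shows "ravg_comp R (ravg_comp R' h g) f = ravg_comp R h (ravg_comp R g f)"
  using compose_assoc[of "fst f" "carrier (alg R)" "carrier (alg R')" "fst h" "fst g"]
    compose_assoc[of "snd f" "carrier (bim R)" "carrier (bim R')" "snd h" "snd g"]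
    ravg_homD(1,4)[OF assms]
  by (auto simp: ravg_comp_def PiE_def)

lemma category_rAvg: "category (rAvg K)"
  by (simp add: category_def rAvg_def id_ravg_hom ravg_comp_ravg_hom ravg_comp_id ravg_comp_assoc)

lemma functor_F: "is_functor (rAvg K) (Diass K) F_obj F_mor"
  by (auto simp: is_functor_def rAvg_def Diass_def diassociative_algebra_F_obj F_mor_diass_hom)
    \<comment> \<open>Identities and composites remain, and the second projection preserves
      both.\<close>
    (simp_all add: F_mor_def ravg_comp_def diass_comp_def)

lemma G_mor_id:
  assumes D: "diassociative_algebra K D"
  shows "G_mor K D D (\<lambda>x\<in>carrier D. x) =
    (\<lambda>a\<in>carrier (alg (G_obj K D)). a, \<lambda>u\<in>carrier (bim (G_obj K D)). u)"
proof -
  interpret D: diass_quotient K D using D by (rule diass_quotient.intro)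
  have "fst (G_mor K D D (\<lambda>x\<in>carrier D. x)) = (\<lambda>a\<in>carrier D.Q. a)"
    using G_mor_ravg_hom(2)[OF D D id_diass_hom[OF D]]
    by (intro D.extensional_Q_eqI) (auto simp: G_mor_def)
  then show ?thesis by (simp add: prod_eq_iff) (simp add: G_mor_def)
qed

text \<open>Both first components send the class of \<open>a\<close> to the class of
  \<open>g (f a)\<close>, and classes exhaust the quotient.\<close>

lemma G_mor_comp:
  assumes D: "diassociative_algebra K D" and D': "diassociative_algebra K D'"
    and D'': "diassociative_algebra K D''"
    and f: "f \<in> diass_hom K D D'" and g: "g \<in> diass_hom K D' D''"
  shows "G_mor K D D'' (diass_comp D g f) =
    ravg_comp (G_obj K D) (G_mor K D' D'' g) (G_mor K D D' f)" (is "?l = ?r")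
proof (rule prod_eqI)
  interpret D: diass_quotient K D using D by (rule diass_quotient.intro)
  show "fst ?l = fst ?r"
  proof (rule D.extensional_Q_eqI)
    fix a assume a: "a \<in> carrier D"
    then have "f a \<in> carrier D'" using diass_homD(1)[OF f] by auto
    then have "fst ?r (D.q a) = ass_class K D'' (diass_comp D g f a)"
      using a by (simp add: G_mor_ravg_hom(2)[OF D D' f] G_mor_ravg_hom(2)[OF D' D'' g]
          ravg_comp_def diass_comp_def compose_eq)
    also have "\<dots> = fst ?l (D.q a)"
      by (rule G_mor_ravg_hom(2)[OF D D'' diass_comp_diass_hom[OF D f g] a, symmetric])
    finally show "fst ?l (D.q a) = fst ?r (D.q a)" ..
  qed (simp_all add: G_mor_def ravg_comp_def)
  show "snd ?l = snd ?r"
    by (simp add: G_mor_def ravg_comp_def diass_comp_def)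
qed

lemma functor_G: "is_functor (Diass K) (rAvg K) (G_obj K) (G_mor K)"
  by (auto simp: is_functor_def rAvg_def Diass_def G_mor_id G_mor_comp G_mor_ravg_hom(1)
      diass_quotient.rel_avg_algebra_G_obj[OF diass_quotient.intro])

text \<open>A category has a single type of objects, so the adjunction ties the types of
  \<open>D\<close>, \<open>M\<close> and \<open>A\<close> together. The second conjunct gives the
  natural bijection with these three types independent.\<close>

theorem proposition3p18:
  fixes K :: "('k, 'e) ring_scheme"
  assumes "field K"
    and char_0: "\<And>n::nat. 0 < n \<Longrightarrow> [n] \<cdot>\<^bsub>K\<^esub> \<one>\<^bsub>K\<^esub> \<noteq> \<zero>\<^bsub>K\<^esub>"
  shows
    "left_adjoint
       (Diass K :: (('k, 'u) diass, 'u \<Rightarrow> 'u) cat)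
       (rAvg K :: (('k, 'u, 'u set) ravg, ('u set \<Rightarrow> 'u set) \<times> ('u \<Rightarrow> 'u)) cat)
       (G_obj K) (G_mor K) F_obj F_mor
     \<and>
     (\<exists>\<Phi> :: ('k, 'd) diass \<Rightarrow> ('k, 'm, 'a) ravg \<Rightarrow> ('d \<Rightarrow> 'm) \<Rightarrow> ('d set \<Rightarrow> 'a) \<times> ('d \<Rightarrow> 'm).
       (\<forall>D R. diassociative_algebra K D \<longrightarrow> rel_avg_algebra K R \<longrightarrow>
          bij_betw (\<Phi> D R) (diass_hom K D (F_obj R)) (ravg_hom K (G_obj K D) R)) \<and>
       (\<forall>D D' R R'. diassociative_algebra K D \<longrightarrow> diassociative_algebra K D' \<longrightarrow>
          rel_avg_algebra K R \<longrightarrow> rel_avg_algebra K R' \<longrightarrow>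
          (\<forall>f \<in> diass_hom K D' D. \<forall>g \<in> ravg_hom K R R'. \<forall>h \<in> diass_hom K D (F_obj R).
             \<Phi> D' R' (diass_comp D' (diass_comp D (F_mor R R' g) h) f) =
             ravg_comp (G_obj K D') (ravg_comp (G_obj K D) g (\<Phi> D R h)) (G_mor K D' D f))))"
proof
  \<comment> \<open>The polymorphic \<open>ravg_transpose K\<close> is the witness in both
    conjuncts, at different types.\<close>
  show "left_adjoint (Diass K) (rAvg K) (G_obj K) (G_mor K) F_obj F_mor"
    unfolding left_adjoint_def
    by (intro conjI category_Diass category_rAvg functor_F functor_G
        exI[of _ "ravg_transpose K"])
      (auto simp: Diass_def rAvg_def ravg_transpose_natural
        diass_quotient.bij_betw_ravg_transpose[OF diass_quotient.intro])
qed (intro exI[of _ "ravg_transpose K"],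
    auto simp: diass_quotient.bij_betw_ravg_transpose[OF diass_quotient.intro]
      ravg_transpose_natural)

end
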